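(* Let $n\ge1$. The function \[ \mu^{\mathbb{T}}:D^{III}_n\to\mathbb{R},\qquad \mu^{\mathbb{T}}(Z)=-2\,\mathrm{tr}\big((I_n-Z\overline{Z})^{-1}\big), \] is a moment map for the Abelian Elliptic Action $\mathbb{T}\times D^{III}_n\to D^{III}_n$, $t\cdot Z=t^2Z$, with respect to the K\"ahler form $\omega^{D^{III}_n}$.
   Context: $D^{III}_n=\{Z\in\mathrm{Symm}(n,\mathbb{C}) : I_n-Z\overline{Z}>0\}$. Its K\"ahler form is $\omega=-2\,\mathrm{Im}(g)$, with $g$ the Bergman metric $g=\frac{1}{n+1}\sum\frac{\partial^2\log K(Z,Z)}{\partial z_{lm}\partial\overline{z}_{jk}}dz_{lm}\otimes d\overline{z}_{jk}$ (sum over $l\le m$, $j\le k$), $K(Z,W)=\det(I_n-Z\overline{W})^{-(n+1)}$; explicitly \[ \omega_Z(U,V)=i\,\mathrm{tr}\big((I_n-Z\overline{Z})^{-1}U(I_n-\overline{Z}Z)^{-1}\overline{V}\big)-i\,\mathrm{tr}\big((I_n-\overline{Z}Z)^{-1}\overline{U}(I_n-Z\overline{Z})^{-1}V\big),\quad U,V\in\mathrm{Symm}(n,\mathbb{C}). \] Moment map: for a Lie group $H$ with Lie algebra $\mathfrak{h}$ acting by symplectomorphisms on a symplectic manifold $(M,\omega)$, a moment map is a smooth map $\mu:M\to\mathfrak{h}^*$ such that (1) for every $X\in\mathfrak{h}$ the function $\mu_X(z)=\langle\mu(z),X\rangle$ satisfies $d\mu_X=\omega(X^\sharp,\cdot)$,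 where $X^\sharp_z=\frac{d}{ds}\big|_{s=0}\exp(sX)\cdot z$; and (2) $\mu(h\cdot z)=\mathrm{Ad}^*(h)(\mu(z))$ for all $h\in H$, $z\in M$ (for Abelian $H$: $\mu(h\cdot z)=\mu(z)$). Here the Lie algebra of $\mathbb{T}$ is $\mathbb{R}$ with exponential map $t\mapsto e^{it}$, and $\mathbb{R}^*$ is identified with $\mathbb{R}$ by multiplication. *)

theory Defs
  imports "HOL-Analysis.Analysis"
begin

section \<open>Manifolds that are open subsets of a linear space\<close>

text \<open>
  All manifolds below are relatively open subsets \<open>M\<close> of a real linear subspace \<open>V\<close> of a normed
  space, so that every tangent space is \<open>V\<close>.  A derivative within \<open>M\<close> is determined only
  on \<open>V\<close>; accordingly, only its values on \<open>V\<close> are ever used.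
\<close>

primrec Ck_on :: "nat \<Rightarrow> 'a::real_normed_vector set \<Rightarrow> 'a set \<Rightarrow> ('a \<Rightarrow> 'b::real_normed_vector) \<Rightarrow> bool"
  where
    "Ck_on 0 V M = (\<lambda>f. continuous_on M f)"
  | "Ck_on (Suc k) V M = (\<lambda>f. \<exists>f'. (\<forall>x\<in>M. (f has_derivative f' x) (at x within M)) \<and>
                                  (\<forall>v\<in>V. Ck_on k V M (\<lambda>x. f' x v)))"

definition smooth_in :: "'a::real_normed_vector set \<Rightarrow> 'a set \<Rightarrow> ('a \<Rightarrow> 'b::real_normed_vector) \<Rightarrow> bool"
  where "smooth_in V M f \<longleftrightarrow> (\<forall>k. Ck_on k V M f)"

definition open_submanifold :: "'a::real_normed_vector set \<Rightarrow> 'a set \<Rightarrow> bool"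
  where "open_submanifold V M \<longleftrightarrow> subspace V \<and> openin (top_of_set V) M"

text \<open>
  In the closedness clause the vector fields \<open>u\<close>, \<open>v\<close>, \<open>w\<close> are constant, hence commute, so that
  \<open>d\<omega>(u,v,w)\<close> is the cyclic sum of directional derivatives.
\<close>

definition symplectic_form :: "'a::real_normed_vector set \<Rightarrow> 'a set \<Rightarrow> ('a \<Rightarrow> 'a \<Rightarrow> 'a \<Rightarrow> real) \<Rightarrow> bool"
  where "symplectic_form V M \<omega> \<longleftrightarrow>
    open_submanifold V M \<and>
    (\<forall>x\<in>M. \<forall>u\<in>V. \<forall>v\<in>V. \<forall>w\<in>V. \<forall>a b. \<omega> x (a *\<^sub>R u + b *\<^sub>R v) w = a * \<omega> x u w + b * \<omega> x v w) \<and>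
    (\<forall>x\<in>M. \<forall>u\<in>V. \<forall>v\<in>V. \<omega> x u v = - \<omega> x v u) \<and>
    (\<forall>x\<in>M. \<forall>u\<in>V. (\<forall>v\<in>V. \<omega> x u v = 0) \<longrightarrow> u = 0) \<and>
    (\<forall>u\<in>V. \<forall>v\<in>V. smooth_in V M (\<lambda>x. \<omega> x u v)) \<and>
    (\<forall>x\<in>M. \<forall>u\<in>V. \<forall>v\<in>V. \<forall>w\<in>V.
       vector_derivative (\<lambda>s. \<omega> (x + s *\<^sub>R u) v w) (at 0) +
       vector_derivative (\<lambda>s. \<omega> (x + s *\<^sub>R v) w u) (at 0) +
       vector_derivative (\<lambda>s. \<omega> (x + s *\<^sub>R w) u v) (at 0) = 0)"


section \<open>Actions of the circle and their moment maps\<close>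

text \<open>
  The circle is \<open>sphere 0 1\<close> in the complex plane.  Its smooth structure is the one for which
  the covering \<open>cis\<close> is a local diffeomorphism, so smoothness of an action is expressed
  on \<open>\<real> \<times> M\<close>.
\<close>

definition smooth_circle_action :: "'a::real_normed_vector set \<Rightarrow> 'a set \<Rightarrow> (complex \<Rightarrow> 'a \<Rightarrow> 'a) \<Rightarrow> bool"
  where "smooth_circle_action V M act \<longleftrightarrow>
    (\<forall>t\<in>sphere 0 1. \<forall>x\<in>M. act t x \<in> M) \<and>
    (\<forall>x\<in>M. act 1 x = x) \<and>
    (\<forall>s\<in>sphere 0 1. \<forall>t\<in>sphere 0 1. \<forall>x\<in>M. act (s * t) x = act s (act t x)) \<and>
    smooth_in (UNIV \<times> V) (UNIV \<times> M) (\<lambda>(s::real, x). act (cis s) x)"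

definition preserves_form :: "'a::real_normed_vector set \<Rightarrow> 'a set \<Rightarrow> ('a \<Rightarrow> 'a \<Rightarrow> 'a \<Rightarrow> real) \<Rightarrow> ('a \<Rightarrow> 'a) \<Rightarrow> bool"
  where "preserves_form V M \<omega> f \<longleftrightarrow>
    (\<forall>x\<in>M. \<exists>L. (f has_derivative L) (at x within M) \<and>
       (\<forall>u\<in>V. L u \<in> V) \<and> (\<forall>u\<in>V. \<forall>v\<in>V. \<omega> (f x) (L u) (L v) = \<omega> x u v))"

text \<open>The Lie algebra of the circle is \<open>\<real>\<close>, with exponential map \<open>cis\<close>.\<close>

definition fundamental_field :: "(complex \<Rightarrow> 'a::real_normed_vector \<Rightarrow> 'a) \<Rightarrow> real \<Rightarrow> 'a \<Rightarrow> 'a"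
  where "fundamental_field act X x = vector_derivative (\<lambda>s. act (cis (s * X)) x) (at 0)"

text \<open>
  The dual of the Lie algebra \<open>\<real>\<close> is identified with \<open>\<real>\<close> by multiplication, so the component of
  \<open>\<mu>\<close> along \<open>X\<close> is \<open>\<lambda>x. \<mu> x * X\<close>.  The circle is Abelian, so equivariance is invariance.
\<close>

definition circle_moment_map ::
    "'a::real_normed_vector set \<Rightarrow> 'a set \<Rightarrow> ('a \<Rightarrow> 'a \<Rightarrow> 'a \<Rightarrow> real) \<Rightarrow> (complex \<Rightarrow> 'a \<Rightarrow> 'a) \<Rightarrow> ('a \<Rightarrow> real) \<Rightarrow> bool"
  where "circle_moment_map V M \<omega> act \<mu> \<longleftrightarrow>
    symplectic_form V M \<omega> \<and>
    smooth_circle_action V M act \<and>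
    (\<forall>t\<in>sphere 0 1. preserves_form V M \<omega> (act t)) \<and>
    smooth_in V M \<mu> \<and>
    (\<forall>X. \<forall>x\<in>M. \<exists>L. ((\<lambda>y. \<mu> y * X) has_derivative L) (at x within M) \<and>
       (\<forall>v\<in>V. L v = \<omega> x (fundamental_field act X x) v)) \<and>
    (\<forall>t\<in>sphere 0 1. \<forall>x\<in>M. \<mu> (act t x) = \<mu> x)"


section \<open>The third Cartan domain and its Bergman metric\<close>

text \<open>
  The index type is ordered because the coordinates on the symmetric matrices are the
  entries \<open>Z $ l $ m\<close> with \<open>l \<le> m\<close>.
\<close>

type_synonym 'n cmat = "complex ^ 'n ^ 'n"

definition Symm :: "'n::finite cmat set"
  where "Symm = {Z. transpose Z = Z}"

abbreviation conj_mat :: "'n::finite cmat \<Rightarrow> 'n cmat"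
  where "conj_mat \<equiv> map_matrix cnj"

abbreviation cscale :: "complex \<Rightarrow> 'n::finite cmat \<Rightarrow> 'n cmat"
  where "cscale c \<equiv> map_matrix ((*) c)"

definition pos_def :: "'n::finite cmat \<Rightarrow> bool"
  where "pos_def H \<longleftrightarrow> conj_mat (transpose H) = H \<and>
    (\<forall>v. v \<noteq> 0 \<longrightarrow> 0 < Re (\<Sum>i\<in>UNIV. cnj (v $ i) * (H *v v) $ i))"

definition D_III :: "'n::finite cmat set"
  where "D_III = {Z \<in> Symm. pos_def (mat 1 - Z ** conj_mat Z)}"

definition bergman_kernel :: "'n::finite cmat \<Rightarrow> 'n cmat \<Rightarrow> complex"
  where "bergman_kernel Z W = inverse (det (mat 1 - Z ** conj_mat W) ^ (CARD('n) + 1))"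

text \<open>
  The direction of the coordinate \<open>Z $ l $ m\<close> on the symmetric matrices; it has two nonzero
  entries when \<open>l \<noteq> m\<close>.
\<close>

definition coord_dir :: "'n \<Rightarrow> 'n \<Rightarrow> 'n::finite cmat"
  where "coord_dir l m = (\<chi> i j. if i = l \<and> j = m \<or> i = m \<and> j = l then 1 else 0)"

definition dir_deriv :: "'n::finite cmat \<Rightarrow> ('n cmat \<Rightarrow> complex) \<Rightarrow> 'n cmat \<Rightarrow> complex"
  where "dir_deriv E f Z = vector_derivative (\<lambda>s. f (Z + s *\<^sub>R E)) (at 0)"

definition d_dz :: "'n \<Rightarrow> 'n \<Rightarrow> ('n::finite cmat \<Rightarrow> complex) \<Rightarrow> 'n cmat \<Rightarrow> complex"
  where "d_dz l m f Z =
    (dir_deriv (coord_dir l m) f Z - \<i> * dir_deriv (cscale \<i> (coord_dir l m)) f Z) / 2"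

definition d_dzbar :: "'n \<Rightarrow> 'n \<Rightarrow> ('n::finite cmat \<Rightarrow> complex) \<Rightarrow> 'n cmat \<Rightarrow> complex"
  where "d_dzbar j k f Z =
    (dir_deriv (coord_dir j k) f Z + \<i> * dir_deriv (cscale \<i> (coord_dir j k)) f Z) / 2"

definition bergman_metric :: "'n::{finite,linorder} cmat \<Rightarrow> 'n cmat \<Rightarrow> 'n cmat \<Rightarrow> complex"
  where "bergman_metric Z U V = 1 / (of_nat CARD('n) + 1) *
    (\<Sum>(l, m)\<in>{(l, m). l \<le> m}. \<Sum>(j, k)\<in>{(j, k). j \<le> k}.
       d_dz l m (d_dzbar j k (\<lambda>Y. Ln (bergman_kernel Y Y))) Z * U $ l $ m * cnj (V $ j $ k))"

definition kahler_form :: "'n::{finite,linorder} cmat \<Rightarrow> 'n cmat \<Rightarrow> 'n cmat \<Rightarrow> real"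
  where "kahler_form Z U V = - 2 * Im (bergman_metric Z U V)"

definition elliptic_action :: "complex \<Rightarrow> 'n::finite cmat \<Rightarrow> 'n cmat"
  where "elliptic_action t Z = cscale (t\<^sup>2) Z"

text \<open>
  The trace below is real on \<open>D_III\<close>, but is a term of type \<^typ>\<open>complex\<close>; the real part only
  adjusts the type.
\<close>

definition mu_T :: "'n::finite cmat \<Rightarrow> real"
  where "mu_T Z = Re (- 2 * trace (matrix_inv (mat 1 - Z ** conj_mat Z)))"

end

theory Submission
  imports Defs
begin

text \<open>
  Write \<open>Z'\<close> for the conjugate of \<open>Z\<close>, \<open>A = (1 - Z Z')\<^sup>-\<^sup>1\<close> and \<open>A'\<close> for its conjugate.  On symmetric
  matrices \<open>A\<^sup>T = A'\<close>, \<open>A Z = Z A'\<close> and \<open>A' = 1 + Z' A Z\<close>.  With Jacobi's formula for the derivative of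
  the determinant these identities turn the Bergman metric into \<open>g(U, V) = tr (A U A' V')\<close>.
  The derivative of \<open>A\<close> in direction \<open>V\<close> is \<open>A (V Z' + Z V') A\<close>, whose trace is \<open>2 Re g(Z, V)\<close>; as the
  fundamental field of \<open>X\<close> is \<open>2 i X Z\<close> and \<open>\<omega> = - 2 Im g\<close>, this is the Hamiltonian equation.
  The form is closed because the derivative of \<open>g(V, W)\<close> in direction \<open>U\<close> is a sum of values of
  \<open>F(a, b, c) = tr (A a A' Z' b A' c')\<close> and of its conjugate at permutations of \<open>U, V, W\<close>, whose
  imaginary parts cancel in the cyclic sum, and nondegenerate because \<open>g(U, W) = \<parallel>W\<parallel>\<^sup>2\<close> for \<open>W = A U A'\<close>.
\<close>

section \<open>Calculus of k-times differentiable functions\<close>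

text \<open>Derivatives are taken within \<open>M\<close>, so values off \<open>M\<close> do not
  matter. This lets \<open>kahler_form\<close> be replaced by a closed formula that is available
  only on \<open>D_III\<close>.\<close>

lemma Ck_on_cong:
  assumes "Ck_on k V M f" and eq: "\<And>x. x \<in> M \<Longrightarrow> f x = g x"
  shows "Ck_on k V M g"
proof (cases k)
  case 0
  with assms show ?thesis by (auto intro: continuous_on_eq)
next
  case (Suc m)
  then obtain f' where f': "\<And>x. x \<in> M \<Longrightarrow> (f has_derivative f' x) (at x within M)"
    and C: "\<And>v. v \<in> V \<Longrightarrow> Ck_on m V M (\<lambda>x. f' x v)"
    using assms(1) by auto
  have "(g has_derivative f' x) (at x within M)" if "x \<in> M" for x
    by (rule has_derivative_transform[OF that _ f'[OF that]]) (simp add: eq)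
  with C Suc show ?thesis by auto
qed

lemma smooth_in_cong:
  assumes "smooth_in V M f" and "\<And>x. x \<in> M \<Longrightarrow> f x = g x"
  shows "smooth_in V M g"
  using assms Ck_on_cong unfolding smooth_in_def by blast

lemma Ck_on_SucI:
  assumes "\<And>x. x \<in> M \<Longrightarrow> (f has_derivative f' x) (at x within M)"
    and "\<And>v. v \<in> V \<Longrightarrow> Ck_on k V M (\<lambda>x. f' x v)"
  shows "Ck_on (Suc k) V M f"
  using assms by auto

lemma Ck_on_SucE:
  assumes "Ck_on (Suc k) V M f"
  obtains f' where "\<And>x. x \<in> M \<Longrightarrow> (f has_derivative f' x) (at x within M)"
    and "\<And>v. v \<in> V \<Longrightarrow> Ck_on k V M (\<lambda>x. f' x v)"
  using assms by auto

text \<open>The product rule leaves one factor undifferentiated; this lowers its order to that of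
  the differentiated one.\<close>

lemma Ck_on_SucD: "Ck_on (Suc k) V M f \<Longrightarrow> Ck_on k V M f"
proof (induction k arbitrary: f)
  case 0
  then show ?case by (auto intro: has_derivative_continuous_on)
next
  case (Suc k)
  from Suc.prems show ?case
    by (rule Ck_on_SucE) (rule Ck_on_SucI, assumption, rule Suc.IH)
qed

lemma Ck_on_const: "Ck_on k V M (\<lambda>x. c)"
proof (induction k arbitrary: c)
  case (Suc k)
  show ?case
    by (rule Ck_on_SucI[where f' = "\<lambda>x v. 0"]) (simp_all add: Suc.IH)
qed simp

lemma Ck_on_linear:
  assumes "bounded_linear f"
  shows "Ck_on k V M f"
proof (cases k)
  case 0
  then show ?thesis by (simp add: assms linear_continuous_on)
next
  case (Suc m)
  show ?thesis unfolding Suc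
    by (rule Ck_on_SucI[where f' = "\<lambda>x v. f v"])
      (simp_all add: assms bounded_linear_imp_has_derivative Ck_on_const)
qed

lemma Ck_on_linear_compose:
  assumes g: "bounded_linear g"
  shows "Ck_on k V M f \<Longrightarrow> Ck_on k V M (\<lambda>x. g (f x))"
proof (induction k arbitrary: f)
  case 0
  then show ?case by (simp add: bounded_linear.continuous_on[OF g])
next
  case (Suc k)
  from Suc.prems obtain f' where f': "\<And>x. x \<in> M \<Longrightarrow> (f has_derivative f' x) (at x within M)"
    and C: "\<And>v. v \<in> V \<Longrightarrow> Ck_on k V M (\<lambda>x. f' x v)"
    by auto
  show ?case
    by (rule Ck_on_SucI[OF bounded_linear.has_derivative[OF g f']]) (simp_all add: Suc.IH C)
qed

lemma Ck_on_add:
  "Ck_on k V M f \<Longrightarrow> Ck_on k V M g \<Longrightarrow> Ck_on k V M (\<lambda>x. f x + g x)"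
proof (induction k arbitrary: f g)
  case 0
  then show ?case by (simp add: continuous_on_add)
next
  case (Suc k)
  obtain f' where f': "\<And>x. x \<in> M \<Longrightarrow> (f has_derivative f' x) (at x within M)"
    "\<And>v. v \<in> V \<Longrightarrow> Ck_on k V M (\<lambda>x. f' x v)"
    using Suc.prems(1) by auto
  obtain g' where g': "\<And>x. x \<in> M \<Longrightarrow> (g has_derivative g' x) (at x within M)"
    "\<And>v. v \<in> V \<Longrightarrow> Ck_on k V M (\<lambda>x. g' x v)"
    using Suc.prems(2) by auto
  show ?case
    by (rule Ck_on_SucI[OF has_derivative_add[OF f'(1) g'(1)]]) (simp_all add: Suc.IH f' g')
qed

text \<open>By the product rule a directional derivative is a sum of two values of \<open>h\<close>
  on functions of order \<open>k\<close>, so the induction closes. One lemma thus serves both matrix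
  products and scalar multiples.\<close>

lemma Ck_on_bilinear:
  assumes h: "bounded_bilinear h"
  shows "Ck_on k V M f \<Longrightarrow> Ck_on k V M g \<Longrightarrow> Ck_on k V M (\<lambda>x. h (f x) (g x))"
proof (induction k arbitrary: f g)
  case 0
  then show ?case by (simp add: bounded_bilinear.continuous_on[OF h])
next
  case (Suc k)
  obtain f' where f': "\<And>x. x \<in> M \<Longrightarrow> (f has_derivative f' x) (at x within M)"
    "\<And>v. v \<in> V \<Longrightarrow> Ck_on k V M (\<lambda>x. f' x v)"
    using Suc.prems(1) by auto
  obtain g' where g': "\<And>x. x \<in> M \<Longrightarrow> (g has_derivative g' x) (at x within M)"
    "\<And>v. v \<in> V \<Longrightarrow> Ck_on k V M (\<lambda>x. g' x v)"
    using Suc.prems(2) by auto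
  show ?case
    by (rule Ck_on_SucI[OF bounded_bilinear.FDERIV[OF h f'(1) g'(1)]])
      (auto intro!: Ck_on_add Suc.IH f' g' Suc.prems[THEN Ck_on_SucD])
qed

text \<open>The derivative in a fixed direction is a fixed real-linear map applied to the same
  function, so the induction hypothesis suffices.\<close>

lemma Ck_on_cis:
  assumes "bounded_linear \<theta>"
  shows "Ck_on k V M (\<lambda>x. cis (\<theta> x))"
proof (induction k)
  case 0
  show ?case
    using continuous_on_cis[OF linear_continuous_on[OF assms]] by simp
next
  case (Suc k)
  have 1: "((\<lambda>x. cis (\<theta> x)) has_derivative (\<lambda>v. \<theta> v *\<^sub>R (\<i> * cis (\<theta> x)))) (at x within M)" for x
    by (intro has_derivative_cis bounded_linear_imp_has_derivative assms)
  have 2: "bounded_linear (\<lambda>z. r *\<^sub>R (\<i> * z))" for r :: real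
    by (intro bounded_linear_intros)
  show ?case
    by (rule Ck_on_SucI[OF 1 Ck_on_linear_compose[OF 2 Suc.IH]])
qed


section \<open>Complex matrices as a real normed algebra\<close>

text \<open>In finite dimension bilinearity already gives boundedness, so no norm estimate is
  made.\<close>

lemma bounded_bilinear_matrix_mult:
  "bounded_bilinear ((**) :: 'n::finite cmat \<Rightarrow> 'n cmat \<Rightarrow> 'n cmat)"
  unfolding bilinear_conv_bounded_bilinear[symmetric] bilinear_def
  by (auto intro!: linearI simp: matrix_add_ldistrib matrix_scalar_ac scalar_matrix_assoc[symmetric])
    (simp_all add: matrix_matrix_mult_def vec_eq_iff algebra_simps sum.distrib scaleR_sum_right)

interpretation matrix_mult: bounded_bilinear "(**) :: 'n::finite cmat \<Rightarrow> 'n cmat \<Rightarrow> 'n cmat"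
  by (rule bounded_bilinear_matrix_mult)

lemma bounded_linear_conj_mat: "bounded_linear (conj_mat :: 'n::finite cmat \<Rightarrow> 'n cmat)"
  unfolding linear_conv_bounded_linear[symmetric]
  by (auto intro!: linearI simp: vec_eq_iff)

lemma has_derivative_conj_mat: "(conj_mat has_derivative conj_mat) F"
  by (rule bounded_linear_imp_has_derivative[OF bounded_linear_conj_mat])

lemma bounded_linear_trace: "bounded_linear (trace :: 'n::finite cmat \<Rightarrow> complex)"
  unfolding linear_conv_bounded_linear[symmetric]
  by (auto intro!: linearI simp: trace_def sum.distrib scaleR_sum_right)

lemma bounded_bilinear_cscale:
  "bounded_bilinear (cscale :: complex \<Rightarrow> 'n::finite cmat \<Rightarrow> 'n cmat)"
  unfolding bilinear_conv_bounded_bilinear[symmetric] bilinear_def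
  by (auto intro!: linearI simp: vec_eq_iff algebra_simps)

lemma bounded_linear_entry: "bounded_linear (\<lambda>A :: 'n::finite cmat. A $ i $ j)"
  by (rule bounded_linear_compose[OF bounded_linear_vec_nth bounded_linear_vec_nth])

lemma conj_mat_mult: "conj_mat (A ** B) = conj_mat A ** conj_mat (B :: 'n::finite cmat)"
  by (simp add: vec_eq_iff matrix_matrix_mult_def)

lemma conj_mat_conj_mat [simp]: "conj_mat (conj_mat A) = (A :: 'n::finite cmat)"
  by (simp add: vec_eq_iff)

lemma conj_mat_mat_1 [simp]: "conj_mat (mat 1) = (mat 1 :: 'n::finite cmat)"
  by (simp add: vec_eq_iff mat_def)

lemma conj_mat_add: "conj_mat (A + B) = conj_mat A + conj_mat (B :: 'n::finite cmat)"
  and conj_mat_diff: "conj_mat (A - B) = conj_mat A - conj_mat B"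
  and conj_mat_scaleR: "conj_mat (r *\<^sub>R A) = r *\<^sub>R conj_mat A"
  by (simp_all add: vec_eq_iff)

lemma conj_mat_cscale: "conj_mat (cscale c A) = cscale (cnj c) (conj_mat (A :: 'n::finite cmat))"
  by (simp add: vec_eq_iff)

lemma transpose_conj_mat: "transpose (conj_mat A) = conj_mat (transpose (A :: 'n::finite cmat))"
  by (simp add: vec_eq_iff transpose_def)

lemma cscale_mult_left: "cscale c A ** B = cscale c (A ** (B :: 'n::finite cmat))"
  and cscale_mult_right: "A ** cscale c B = cscale c (A ** B)"
  by (simp_all add: vec_eq_iff matrix_matrix_mult_def sum_distrib_left algebra_simps)

lemma cscale_cscale [simp]: "cscale c (cscale d A) = cscale (c * d) (A :: 'n::finite cmat)"
  by (simp add: vec_eq_iff)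

lemma cscale_1 [simp]: "cscale 1 A = (A :: 'n::finite cmat)"
  by (simp add: vec_eq_iff)

lemma trace_cscale: "trace (cscale c A) = c * trace (A :: 'n::finite cmat)"
  by (simp add: trace_def sum_distrib_left)

lemma trace_conj_mat: "trace (conj_mat A) = cnj (trace (A :: 'n::finite cmat))"
  by (simp add: trace_def)

lemma trace_transpose: "trace (transpose A) = trace (A :: 'n::finite cmat)"
  by (simp add: trace_def transpose_def)

lemma det_conj_mat: "det (conj_mat A) = cnj (det (A :: 'n::finite cmat))"
  by (simp add: det_def)

section \<open>Inverse and determinant: continuity and derivatives\<close>

lemma matrix_inv_cancel:
  fixes A :: "'a::field ^ 'n ^ 'n"
  assumes "det A \<noteq> 0"
  shows matrix_inv_right_inverse: "A ** matrix_inv A = mat 1"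
    and matrix_inv_left_inverse: "matrix_inv A ** A = mat 1"
proof -
  have "\<exists>B. A ** B = mat 1 \<and> B ** A = mat 1"
    using assms unfolding invertible_det_nz[symmetric] invertible_def .
  then have "A ** matrix_inv A = mat 1 \<and> matrix_inv A ** A = mat 1"
    unfolding matrix_inv_def by (rule someI_ex)
  then show "A ** matrix_inv A = mat 1" "matrix_inv A ** A = mat 1" by auto
qed

lemma continuous_on_det:
  fixes P :: "'a::topological_space \<Rightarrow> 'n::finite cmat"
  assumes "continuous_on S P"
  shows "continuous_on S (\<lambda>x. det (P x))"
  unfolding det_def by (intro continuous_intros assms)

lemma open_det_nonzero: "open {A :: 'n::finite cmat. det A \<noteq> 0}"
  by (intro open_Collect_neq continuous_on_det continuous_intros)

text \<open>By Cramer's rule the entries of the inverse are quotients of determinants.\<close>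

lemma continuous_on_matrix_inv: "continuous_on {A :: 'n::finite cmat. det A \<noteq> 0} matrix_inv"
proof -
  \<comment> \<open>The determinant of \<open>A\<close> with column \<open>k\<close> replaced by the
    unit vector \<open>axis j 1\<close>: the Cramer numerator for entry \<open>(k, j)\<close> of the
    inverse.\<close>
  let ?C = "\<lambda>A j k. det (\<chi> a b. if b = k then (axis j 1 :: complex^'n) $ a else A $ a $ b)"
  let ?R = "\<lambda>A. \<chi> k j. ?C A j k / det A"
  have 1: "continuous_on S (\<lambda>A. ?C A j k)" for S and j k :: 'n
  proof (intro continuous_on_det continuous_on_vec_lambda)
    fix a b
    show "continuous_on S (\<lambda>A. if b = k then (axis j 1 :: complex^'n) $ a else A $ a $ b)"
      by (cases "b = k") (auto intro!: continuous_on_component continuous_on_id)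
  qed
  have "continuous_on {A :: 'n cmat. det A \<noteq> 0} ?R"
    by (intro continuous_on_vec_lambda continuous_on_divide 1 continuous_on_det continuous_on_id) auto
  moreover have "?R A = matrix_inv A" if "det A \<noteq> 0" for A :: "'n cmat"
  proof -
    have "column j (?R A) = column j (matrix_inv A)" for j
    proof -
      have "A *v column j (matrix_inv A) = axis j 1"
      proof -
        have "A *v column j (matrix_inv A) = column j (A ** matrix_inv A)"
          by (simp add: vec_eq_iff matrix_vector_mult_def matrix_matrix_mult_def column_def)
        then show ?thesis
          by (simp add: matrix_inv_right_inverse[OF that] vec_eq_iff column_def mat_def axis_def)
      qed
      then show ?thesis
        unfolding cramer[OF that] by (simp add: column_def vec_eq_iff)
    qed
    then show ?thesis by (simp add: vec_eq_iff column_def)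
  qed
  ultimately show ?thesis by (auto intro: continuous_on_eq)
qed

text \<open>The remainder factors as \<open>(?i A - ?i B) ** (B - A) ** ?i A\<close>. Divided by
  \<open>norm (B - A)\<close> it is bounded by a constant times \<open>norm (?i A - ?i B)\<close>,
  which tends to 0 by continuity of the inverse.\<close>

lemma has_derivative_matrix_inv:
  fixes A :: "'n::finite cmat"
  assumes "det A \<noteq> 0"
  shows "(matrix_inv has_derivative (\<lambda>H. - (matrix_inv A ** H ** matrix_inv A))) (at A)"
proof -
  obtain K where K: "K > 0" "\<And>(X :: 'n cmat) (Y :: 'n cmat). norm (X ** Y) \<le> norm X * norm Y * K"
    using bounded_bilinear.pos_bounded[OF bounded_bilinear_matrix_mult[where 'n = 'n]] by blast
  let ?i = matrix_inv
  let ?S = "{B :: 'n cmat. det B \<noteq> 0}"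
  \<comment> \<open>Invertible matrices form an open set, so \<open>B\<close> is invertible
    throughout this ball.\<close>
  obtain e where e: "e > 0" "ball A e \<subseteq> ?S"
    using openE[OF open_det_nonzero, of A] assms by blast
  show ?thesis
  proof (rule has_derivativeI_sandwich[OF e(1)])
    show "bounded_linear (\<lambda>H. - (?i A ** H ** ?i A))"
      by (intro bounded_linear_minus bounded_linear_compose[OF matrix_mult.bounded_linear_left]
          matrix_mult.bounded_linear_right)
    have "isCont ?i A"
      using continuous_on_matrix_inv assms
      unfolding continuous_on_eq_continuous_at[OF open_det_nonzero] by blast
    then have "(?i \<longlongrightarrow> ?i A) (at A)" by (rule isContD)
    then show "((\<lambda>B. norm (?i A - ?i B) * norm (?i A) * K * K) \<longlongrightarrow> 0) (at A within UNIV)"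
      by (rule tendsto_eq_rhs[OF tendsto_mult_right[OF tendsto_mult_right[OF tendsto_mult_right[OF
          tendsto_norm[OF tendsto_diff[OF tendsto_const]]]]]]) simp
    fix B :: "'n cmat" assume B: "B \<noteq> A" "dist B A < e"
    then have dB: "det B \<noteq> 0" using e by (auto simp: dist_commute)
    have 1: "?i B ** (B - A) ** ?i A = ?i A - ?i B"
    proof -
      have "?i B ** (B - A) ** ?i A = ?i B ** B ** ?i A - ?i B ** (A ** ?i A)"
        by (simp add: matrix_mult.diff_right matrix_mult.diff_left matrix_mul_assoc)
      then show ?thesis
        by (simp add: matrix_inv_left_inverse[OF dB] matrix_inv_right_inverse[OF assms])
    qed
    have "?i B - ?i A - - (?i A ** (B - A) ** ?i A) = (?i A - ?i B) ** (B - A) ** ?i A"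
      by (simp add: matrix_mult.diff_left 1)
    also have "norm \<dots> \<le> norm ((?i A - ?i B) ** (B - A)) * norm (?i A) * K"
      by (rule K(2))
    also have "\<dots> \<le> (norm (?i A - ?i B) * norm (B - A) * K) * norm (?i A) * K"
      using K by (intro mult_right_mono) auto
    finally show "norm (?i B - ?i A - - (?i A ** (B - A) ** ?i A)) / norm (B - A)
        \<le> norm (?i A - ?i B) * norm (?i A) * K * K"
      using B by (simp add: divide_simps mult_ac)
  qed
qed

text \<open>The derivative of the inverse is a product of the inverse itself and \<open>P'\<close>;
  order \<open>k\<close> of the inverse therefore yields order \<open>Suc k\<close>.\<close>

lemma Ck_on_matrix_inv:
  fixes P :: "'a::real_normed_vector \<Rightarrow> 'n::finite cmat"
  assumes d: "\<And>x. x \<in> M \<Longrightarrow> det (P x) \<noteq> 0"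
  shows "Ck_on k V M P \<Longrightarrow> Ck_on k V M (\<lambda>x. matrix_inv (P x))"
proof (induction k)
  case 0
  then show ?case
    using d by (auto intro!: continuous_on_compose2[OF continuous_on_matrix_inv])
next
  case (Suc k)
  obtain P' where P': "\<And>x. x \<in> M \<Longrightarrow> (P has_derivative P' x) (at x within M)"
    "\<And>v. v \<in> V \<Longrightarrow> Ck_on k V M (\<lambda>x. P' x v)"
    using Suc.prems by auto
  show ?case
    by (rule Ck_on_SucI[OF has_derivative_compose[OF P'(1) has_derivative_matrix_inv]])
      (use d in \<open>simp_all add: Ck_on_linear_compose[OF bounded_linear_minus[OF bounded_linear_ident]]
        Ck_on_bilinear[OF bounded_bilinear_matrix_mult] Suc.IH P' Ck_on_SucD[OF Suc.prems]\<close>)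
qed

text \<open>Differentiate the Leibniz expansion term by term. A permutation other than
  \<open>id\<close> moves at least two points, so deleting one factor leaves another off-diagonal
  zero; only the term of \<open>id\<close> survives.\<close>

lemma has_derivative_det_mat_1:
  "(det has_derivative trace) (at (mat 1 :: 'n::finite cmat))"
proof -
  let ?I = "mat 1 :: 'n cmat" and ?P = "{p. p permutes (UNIV :: 'n set)}"
  have "(det has_derivative (\<lambda>H. \<Sum>p\<in>?P. of_int (sign p) *
      (\<Sum>i\<in>UNIV. H $ i $ p i * (\<Prod>j\<in>UNIV - {i}. ?I $ j $ p j)))) (at ?I)"
    unfolding det_def
    by (intro has_derivative_sum has_derivative_mult_right has_derivative_prod
        bounded_linear_imp_has_derivative bounded_linear_entry)
  also have "(\<lambda>H. \<Sum>p\<in>?P. of_int (sign p) *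
      (\<Sum>i\<in>UNIV. H $ i $ p i * (\<Prod>j\<in>UNIV - {i}. ?I $ j $ p j))) = trace"
  proof
    fix H :: "'n cmat"
    have z: "(\<Prod>j\<in>UNIV - {i}. ?I $ j $ p j) = 0" if p: "p permutes UNIV" "p \<noteq> id" for p and i :: 'n
    proof -
      obtain a where a: "p a \<noteq> a" using p(2) by fastforce
      \<comment> \<open>Injectivity makes \<open>p a\<close> a second moved point, and at least one
        of the two differs from \<open>i\<close>.\<close>
      then have "p (p a) \<noteq> p a" using permutes_inj[OF p(1)] by (metis injD)
      with a obtain j where "j \<noteq> i" "p j \<noteq> j" by metis
      then have "?I $ j $ p j = 0" by (simp add: mat_def)
      with \<open>j \<noteq> i\<close> show ?thesis by (intro prod_zero) auto
    qed
    have "(\<Sum>p\<in>?P. of_int (sign p) * (\<Sum>i\<in>UNIV. H $ i $ p i * (\<Prod>j\<in>UNIV - {i}. ?I $ j $ p j)))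
      = (\<Sum>p\<in>{id}. of_int (sign p) * (\<Sum>i\<in>UNIV. H $ i $ p i * (\<Prod>j\<in>UNIV - {i}. ?I $ j $ p j)))"
      by (rule sum.mono_neutral_right) (auto simp: permutes_id z)
    then show "(\<Sum>p\<in>?P. of_int (sign p) * (\<Sum>i\<in>UNIV. H $ i $ p i * (\<Prod>j\<in>UNIV - {i}. ?I $ j $ p j)))
      = trace H"
      by (simp add: trace_def sign_id mat_def)
  qed
  finally show ?thesis .
qed

text \<open>Jacobi's formula, carried over from the identity matrix by multiplicativity of the
  determinant.\<close>

lemma has_derivative_det:
  fixes A :: "'n::finite cmat"
  assumes "det A \<noteq> 0"
  shows "(det has_derivative (\<lambda>H. det A * trace (matrix_inv A ** H))) (at A)"
proof -
  have "((\<lambda>B. det A * det (matrix_inv A ** B)) has_derivative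
      (\<lambda>H. det A * trace (matrix_inv A ** H))) (at A)"
  proof (intro has_derivative_mult_right)
    have 1: "((\<lambda>B. matrix_inv A ** B) has_derivative (\<lambda>H. matrix_inv A ** H)) (at A)"
      by (intro bounded_linear_imp_has_derivative matrix_mult.bounded_linear_right)
    show "((\<lambda>B. det (matrix_inv A ** B)) has_derivative (\<lambda>H. trace (matrix_inv A ** H))) (at A)"
      by (rule has_derivative_compose[OF 1])
        (simp add: matrix_inv_left_inverse[OF assms] has_derivative_det_mat_1)
  qed
  also have "(\<lambda>B. det A * det (matrix_inv A ** B)) = det"
  proof
    fix B :: "'n cmat"
    have "det A * det (matrix_inv A ** B) = det (A ** matrix_inv A ** B)"
      by (simp add: det_mul)
    then show "det A * det (matrix_inv A ** B) = det B"
      by (simp add: matrix_inv_right_inverse[OF assms])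
  qed
  finally show ?thesis .
qed


section \<open>The domain\<close>

definition herm_form :: "'n::finite cmat \<Rightarrow> complex ^ 'n \<Rightarrow> real"
  where "herm_form H v = Re (\<Sum>i\<in>UNIV. cnj (v $ i) * (H *v v) $ i)"

lemma pos_def_iff:
  "pos_def H \<longleftrightarrow> conj_mat (transpose H) = H \<and> (\<forall>v. v \<noteq> 0 \<longrightarrow> 0 < herm_form H v)"
  by (simp add: pos_def_def herm_form_def)

lemma herm_form_mat_1: "herm_form (mat 1) v = (norm v)\<^sup>2"
  by (simp add: herm_form_def norm_vec_def L2_set_def sum_nonneg cmod_power2
      flip: power2_eq_square)

lemma herm_form_add: "herm_form (A + B) v = herm_form A v + herm_form B v"
  by (simp add: herm_form_def matrix_vector_mult_add_rdistrib algebra_simps sum.distrib)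

lemma herm_form_scaleR: "herm_form (r *\<^sub>R A) v = r * herm_form A v"
  by (simp add: herm_form_def matrix_vector_mult_def sum_distrib_left mult_ac
      flip: scaleR_sum_right)

lemma herm_form_scaleR_vec: "herm_form A (r *\<^sub>R v) = r\<^sup>2 * herm_form A v"
  by (simp add: herm_form_def matrix_vector_mult_def sum_distrib_left mult_ac power2_eq_square
      flip: scaleR_sum_right)

lemma continuous_on_herm_form:
  "continuous_on S f \<Longrightarrow> continuous_on S g \<Longrightarrow> continuous_on S (\<lambda>x. herm_form (f x) (g x))"
  unfolding herm_form_def matrix_vector_mult_def by (simp, intro continuous_intros)

lemma det_pos_def_nonzero:
  assumes "pos_def H"
  shows "det H \<noteq> 0"
proof -
  have "v = 0" if "H *v v = 0" for v
    using assms that unfolding pos_def_def by force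
  then show ?thesis
    unfolding invertible_det_nz[symmetric] invertible_left_inverse matrix_left_invertible_ker
    by blast
qed

text \<open>Joins \<open>H\<close> to the identity inside the positive definite matrices, which is
  what fixes the sign of the determinant below.\<close>

lemma pos_def_segment:
  assumes "pos_def H" "0 \<le> s" "s \<le> 1"
  shows "pos_def ((1 - s) *\<^sub>R mat 1 + s *\<^sub>R H)"
proof -
  have "0 < (1 - s) * (norm v)\<^sup>2 + s * herm_form H v" if "v \<noteq> 0" for v
  \<comment> \<open>For \<open>s = 0\<close> only the first summand is positive; otherwise the
    second is positive and the first nonnegative.\<close>
  proof (cases "s = 0")
    case False
    then show ?thesis
      using assms that by (intro add_nonneg_pos) (auto simp: pos_def_iff)
  qed (simp add: that)
  moreover have "conj_mat (transpose ((1 - s) *\<^sub>R mat 1 + s *\<^sub>R H)) = (1 - s) *\<^sub>R mat 1 + s *\<^sub>R H"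
  proof -
    have "transpose ((1 - s) *\<^sub>R mat 1 + s *\<^sub>R H) = (1 - s) *\<^sub>R mat 1 + s *\<^sub>R transpose H"
      by (simp add: transpose_def vec_eq_iff mat_def)
    then show ?thesis
      using assms(1) by (simp add: pos_def_iff conj_mat_add conj_mat_scaleR)
  qed
  ultimately show ?thesis
    by (simp add: pos_def_iff herm_form_add herm_form_scaleR herm_form_mat_1)
qed

text \<open>Conjugate transposition fixes \<open>H\<close> and conjugates its determinant, so the
  determinant is real. It is 1 at the identity and has no zero on the segment to \<open>H\<close>.
  This keeps the Bergman kernel off the branch cut of \<open>Ln\<close>.\<close>

lemma det_pos_def:
  assumes "pos_def H"
  shows "Im (det H) = 0" and "Re (det H) > 0"
proof -
  have im: "Im (det G) = 0" if "pos_def G" for G :: "'a::finite cmat"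
  proof -
    have "det G = cnj (det G)"
      using that by (metis pos_def_iff det_conj_mat det_transpose)
    then show ?thesis by (simp add: complex_eq_iff)
  qed
  then show "Im (det H) = 0" using assms .
  let ?h = "\<lambda>s. (1 - s) *\<^sub>R mat 1 + s *\<^sub>R H"
  have nz: "Re (det (?h s)) \<noteq> 0" if "0 \<le> s" "s \<le> 1" for s
    using det_pos_def_nonzero[OF pos_def_segment[OF assms that]] im[OF pos_def_segment[OF assms that]]
    by (auto simp: complex_eq_iff)
  have "continuous_on {0..1} (\<lambda>s. Re (det (?h s)))"
    by (intro continuous_on_Re continuous_on_det continuous_intros)
  then have "\<not> Re (det (?h 1)) \<le> 0"
    using IVT2'[of "\<lambda>s. Re (det (?h s))" 1 0 0] nz by auto
  then show "Re (det H) > 0" by simp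
qed

section \<open>The domain as an open subset of the symmetric matrices\<close>

lemma subspace_Symm: "subspace Symm"
  by (auto simp: subspace_def Symm_def transpose_def vec_eq_iff)

lemma Symm_eqD: "Z \<in> Symm \<Longrightarrow> transpose Z = Z"
  by (simp add: Symm_def)

lemma conj_mat_in_Symm: "Z \<in> Symm \<Longrightarrow> conj_mat Z \<in> Symm"
  and cscale_in_Symm: "Z \<in> Symm \<Longrightarrow> cscale c Z \<in> Symm"
  by (auto simp: Symm_def transpose_def vec_eq_iff)

lemma defect_hermitian:
  assumes "Z \<in> Symm"
  shows "conj_mat (transpose (mat 1 - Z ** conj_mat Z)) = mat 1 - Z ** conj_mat Z"
proof -
  have "transpose (mat 1 - Z ** conj_mat Z) = mat 1 - transpose (Z ** conj_mat Z)"
    by (simp add: transpose_def vec_eq_iff mat_def)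
  then show ?thesis
    by (simp add: matrix_transpose_mul transpose_conj_mat Symm_eqD[OF assms] conj_mat_diff conj_mat_mult)
qed

lemma D_III_D:
  assumes "Z \<in> D_III"
  shows D_III_Symm: "Z \<in> Symm" and D_III_pos_def: "pos_def (mat 1 - Z ** conj_mat Z)"
    and D_III_det_nonzero: "det (mat 1 - Z ** conj_mat Z) \<noteq> 0"
  using assms det_pos_def_nonzero by (auto simp: D_III_def)

lemma continuous_on_defect: "continuous_on S (\<lambda>Z :: 'n::finite cmat. mat 1 - Z ** conj_mat Z)"
  by (intro continuous_on_diff continuous_on_const matrix_mult.continuous_on continuous_on_id
      linear_continuous_on[OF bounded_linear_conj_mat])

text \<open>A symmetric \<open>Z\<close> lies outside the domain iff some unit vector makes the form
  nonpositive. The set of such pairs is closed, and projecting along the compact sphere keeps it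
  closed.\<close>

lemma openin_D_III: "openin (top_of_set Symm) (D_III :: 'n::finite cmat set)"
proof -
  let ?q = "\<lambda>(v, Z :: 'n cmat). herm_form (mat 1 - Z ** conj_mat Z) v"
  let ?T = "{Z :: 'n cmat. \<exists>v. v \<in> sphere 0 1 \<and> (v, Z) \<in> {p. ?q p \<le> 0}}"
  have "closed {p. ?q p \<le> 0}"
    unfolding case_prod_unfold
    by (intro closed_Collect_le continuous_on_herm_form continuous_on_const
        continuous_on_compose2[OF continuous_on_defect] continuous_on_fst continuous_on_snd
        continuous_on_id) auto
  then have "closed ?T"
    by (intro closed_compact_projection compact_sphere)
  moreover have "D_III = Symm \<inter> - ?T"
  proof (intro set_eqI iffI)
    fix Z :: "'n cmat" assume "Z \<in> D_III"
    then have "Z \<in> Symm" and pos: "v \<noteq> 0 \<Longrightarrow> 0 < herm_form (mat 1 - Z ** conj_mat Z) v" for v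
      by (auto simp: D_III_def pos_def_iff)
    moreover have "\<not> herm_form (mat 1 - Z ** conj_mat Z) v \<le> 0" if "norm v = 1" for v
      using pos[of v] that by fastforce
    ultimately show "Z \<in> Symm \<inter> - ?T" by auto
  next
    fix Z :: "'n cmat" assume Z: "Z \<in> Symm \<inter> - ?T"
    have "0 < herm_form (mat 1 - Z ** conj_mat Z) v" if "v \<noteq> 0" for v
    proof -
      \<comment> \<open>Only unit vectors are controlled by \<open>?T\<close>; the form is
        homogeneous of degree 2, so \<open>v\<close> may be normalised.\<close>
      have "0 < herm_form (mat 1 - Z ** conj_mat Z) (inverse (norm v) *\<^sub>R v)"
        using Z that by (auto simp: not_le)
      then show ?thesis
        using that by (simp add: herm_form_scaleR_vec zero_less_mult_iff)
    qed
    with Z show "Z \<in> D_III" by (auto simp: D_III_def pos_def_iff defect_hermitian)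
  qed
  ultimately show ?thesis
    by (auto simp: openin_open)
qed

text \<open>Derivatives along symmetric directions see only values on the domain, where the closed
  formulas hold. The filter \<open>nhds 0\<close> includes the parameter 0, as congruence of
  \<open>vector_derivative\<close> requires.\<close>

lemma D_III_line:
  fixes Z :: "'n::finite cmat"
  assumes "Z \<in> D_III" "E \<in> Symm"
  shows "\<forall>\<^sub>F s in nhds 0. Z + s *\<^sub>R E \<in> D_III"
proof -
  obtain T :: "'n cmat set" where T: "open T" "D_III = Symm \<inter> T"
    using openin_D_III by (auto simp: openin_open)
  have "((\<lambda>s::real. Z + s *\<^sub>R E) \<longlongrightarrow> Z + 0 *\<^sub>R E) (nhds 0)"
    by (intro tendsto_intros filterlim_ident)
  then have "\<forall>\<^sub>F s in nhds (0::real). Z + s *\<^sub>R E \<in> T"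
    using T assms(1) by (auto simp: tendsto_def)
  moreover have "Z + s *\<^sub>R E \<in> Symm" for s
    by (intro subspace_add[OF subspace_Symm] subspace_scale[OF subspace_Symm] D_III_Symm assms)
  ultimately show ?thesis
    unfolding T by (auto elim: eventually_mono)
qed


section \<open>The resolvent\<close>

text \<open>This is the \<open>A\<close> of the overview, and \<open>conj_mat (res Z)\<close> is its
  \<open>A'\<close>.\<close>

definition res :: "'n::finite cmat \<Rightarrow> 'n cmat"
  where "res Z = matrix_inv (mat 1 - Z ** conj_mat Z)"

text \<open>Multiply the commutation relation by \<open>A\<close> on the left and \<open>B\<close>
  on the right. It is applied with \<open>P\<close> and \<open>Q\<close> the two defects
  \<open>1 - Z Z'\<close> and \<open>1 - Z' Z\<close>, and \<open>X = Z\<close>.\<close>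

lemma matrix_mult_cancel_inverses:
  fixes P :: "'n::finite cmat"
  assumes "A ** P = mat 1" "Q ** B = mat 1" "P ** X = X ** Q"
  shows "A ** X = X ** B"
proof -
  have "A ** X = A ** (X ** Q) ** B"
    by (simp add: assms(2) flip: matrix_mul_assoc)
  also have "\<dots> = A ** P ** X ** B"
    by (simp add: assms(3)[symmetric] matrix_mul_assoc)
  finally show ?thesis by (simp add: assms(1))
qed

context
  fixes Z :: "'n::finite cmat"
  assumes Z: "Z \<in> D_III"
begin

lemma res_left: "res Z ** (mat 1 - Z ** conj_mat Z) = mat 1"
  and res_right: "(mat 1 - Z ** conj_mat Z) ** res Z = mat 1"
  unfolding res_def
  by (simp_all add: matrix_inv_left_inverse matrix_inv_right_inverse D_III_det_nonzero[OF Z])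

lemma conj_res_right: "(mat 1 - conj_mat Z ** Z) ** conj_mat (res Z) = mat 1"
  using res_right[THEN arg_cong[where f = conj_mat]] by (simp add: conj_mat_mult conj_mat_diff)

text \<open>Transposing \<open>res_right\<close> gives a left inverse of \<open>1 - Z' Z\<close>;
  \<open>conj_mat (res Z)\<close> is a right inverse of the same matrix, so the two agree.\<close>

lemma transpose_res: "transpose (res Z) = conj_mat (res Z)"
proof -
  have "transpose (mat 1 - Z ** conj_mat Z) = mat 1 - conj_mat Z ** Z"
    using defect_hermitian[OF D_III_Symm[OF Z], THEN arg_cong[where f = conj_mat]]
    by (simp add: conj_mat_diff conj_mat_mult)
  then have "transpose (res Z) ** (mat 1 - conj_mat Z ** Z) = mat 1"
    using res_right[THEN arg_cong[where f = transpose]] by (simp add: matrix_transpose_mul)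
  then show ?thesis
    by (metis conj_res_right matrix_mul_assoc matrix_mul_lid matrix_mul_rid)
qed

lemma transpose_conj_res: "transpose (conj_mat (res Z)) = res Z"
  by (simp add: transpose_conj_mat transpose_res)

lemma res_mult: "res Z ** Z = Z ** conj_mat (res Z)"
  by (rule matrix_mult_cancel_inverses[OF res_left conj_res_right])
    (simp add: matrix_mult.diff_left matrix_mult.diff_right matrix_mul_assoc)

lemma conj_res_mult: "conj_mat (res Z) ** conj_mat Z = conj_mat Z ** res Z"
  using res_mult[THEN arg_cong[where f = conj_mat]] by (simp add: conj_mat_mult)

text \<open>Expand \<open>A' (1 - Z' Z) = 1\<close> and use \<open>A' Z' = Z' A\<close>. It later
  merges the two terms of the mixed second derivative into one.\<close>

lemma conj_res_expand: "conj_mat (res Z) = mat 1 + conj_mat Z ** res Z ** Z"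
proof -
  have "conj_mat (res Z) ** (mat 1 - conj_mat Z ** Z) = mat 1"
    using conj_res_right matrix_left_right_inverse by blast
  then have "conj_mat (res Z) - conj_mat (res Z) ** conj_mat Z ** Z = mat 1"
    by (simp add: matrix_mult.diff_right matrix_mul_assoc)
  then show ?thesis by (simp add: conj_res_mult diff_eq_eq)
qed

lemma has_derivative_defect:
  "((\<lambda>Y. mat 1 - Y ** conj_mat Y) has_derivative (\<lambda>E. - (E ** conj_mat Z + Z ** conj_mat E))) (at Z)"
  by (auto intro!: derivative_eq_intros matrix_mult.FDERIV[THEN has_derivative_eq_rhs]
      has_derivative_conj_mat)

lemma has_derivative_res:
  "(res has_derivative (\<lambda>E. res Z ** (E ** conj_mat Z + Z ** conj_mat E) ** res Z)) (at Z)"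
  unfolding res_def[abs_def]
  by (rule has_derivative_eq_rhs[OF has_derivative_compose[OF has_derivative_defect
        has_derivative_matrix_inv[OF D_III_det_nonzero[OF Z]]]])
    (simp only: matrix_mult.minus_left matrix_mult.minus_right minus_minus)

end


section \<open>The Bergman metric\<close>

lemma has_vector_derivative_line:
  assumes "(f has_derivative f') (at Z)"
  shows "((\<lambda>s. f (Z + s *\<^sub>R E)) has_vector_derivative f' E) (at 0)"
proof -
  have "((\<lambda>s::real. Z + s *\<^sub>R E) has_derivative (\<lambda>s. s *\<^sub>R E)) (at 0)"
    by (rule has_derivative_eq_rhs[OF has_derivative_add[OF has_derivative_const
          has_derivative_scaleR_left[OF has_derivative_ident]]]) simp
  then have "((\<lambda>s. f (Z + s *\<^sub>R E)) has_derivative (\<lambda>s. f' (s *\<^sub>R E))) (at 0)"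
    by (rule has_derivative_compose) (simp add: assms)
  then show ?thesis
    using has_derivative_linear[OF assms]
    by (simp add: has_vector_derivative_def linear_cmul)
qed

lemma dir_deriv_eqI:
  assumes "(f has_derivative f') (at Z)"
  shows "dir_deriv E f Z = f' E"
  unfolding dir_deriv_def
  by (rule vector_derivative_at[OF has_vector_derivative_line[OF assms]])

text \<open>Lets a first derivative known only on the domain be replaced by its formula before it is
  differentiated again.\<close>

lemma dir_deriv_cong:
  assumes "\<And>Y. Y \<in> D_III \<Longrightarrow> f Y = g Y" "Z \<in> D_III" "E \<in> Symm"
  shows "dir_deriv E f Z = dir_deriv E g Z"
  unfolding dir_deriv_def
  by (rule vector_derivative_cong_eq)
    (use D_III_line[OF assms(2,3)] assms(1) in \<open>auto elim: eventually_mono\<close>)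

lemma coord_dir_in_Symm: "coord_dir l m \<in> Symm"
  by (auto simp: coord_dir_def Symm_def transpose_def vec_eq_iff)

lemma conj_coord_dir: "conj_mat (coord_dir l m) = coord_dir l m"
  by (simp add: coord_dir_def vec_eq_iff)

lemma Symm_expand:
  fixes U :: "'n::{finite,linorder} cmat"
  assumes "U \<in> Symm"
  shows "U = (\<Sum>(l, m)\<in>{(l, m). l \<le> m}. cscale (U $ l $ m) (coord_dir l m))"
proof -
  \<comment> \<open>Entry \<open>(i, j)\<close> meets exactly one ordered coordinate pair,
    \<open>(min i j, max i j)\<close>.\<close>
  have entry: "coord_dir l m $ i $ j = (if (l, m) = (min i j, max i j) then 1 else 0)"
    if "l \<le> m" for l m i j :: 'n
    using that by (cases "i \<le> j") (auto simp: coord_dir_def min_def max_def)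
  have "(\<Sum>(l, m)\<in>{(l, m). l \<le> m}. cscale (U $ l $ m) (coord_dir l m)) $ i $ j = U $ i $ j" for i j
  proof -
    have "(\<Sum>(l, m)\<in>{(l, m). l \<le> m}. cscale (U $ l $ m) (coord_dir l m)) $ i $ j
      = (\<Sum>p\<in>{(l, m). l \<le> m}. if p = (min i j, max i j) then U $ fst p $ snd p else 0)"
      unfolding sum_component by (rule sum.cong) (auto simp: entry split: if_splits)
    also have "\<dots> = U $ min i j $ max i j"
      by (subst sum.delta) (auto simp: min_le_iff_disj le_max_iff_disj)
    also have "\<dots> = U $ i $ j"
    proof -
      have "transpose U $ i $ j = U $ i $ j" using Symm_eqD[OF assms] by simp
      then show ?thesis by (simp add: min_def max_def transpose_def)
    qed
    finally show ?thesis .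
  qed
  then show ?thesis
    unfolding vec_eq_iff by metis
qed

text \<open>The closed form of the Bergman metric on symmetric arguments; unlike the coordinate sum
  it needs no order on the index type.\<close>

definition metric_form :: "'n::finite cmat \<Rightarrow> 'n cmat \<Rightarrow> 'n cmat \<Rightarrow> complex"
  where "metric_form Z U V = trace (res Z ** U ** conj_mat (res Z) ** conj_mat V)"

lemma trace_add_mult:
  "trace (A ** (B + C)) = trace (A ** B) + trace (A ** (C :: 'n::finite cmat))"
  by (simp add: matrix_add_ldistrib trace_add)

text \<open>The derivative is written as a multiple of the function value, so that the kernel
  cancels in its logarithmic derivative.\<close>

lemma DERIV_inverse_power_Suc:
  fixes d :: complex
  assumes "d \<noteq> 0"
  shows "((\<lambda>x. inverse (x ^ Suc m)) has_field_derivative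
    (- of_nat (Suc m) * inverse (d ^ Suc m) / d)) (at d)"
proof -
  have "((\<lambda>x. inverse (x ^ Suc m)) has_field_derivative
      - (inverse (d ^ Suc m) * (of_nat (Suc m) * d ^ m) * inverse (d ^ Suc m))) (at d)"
    by (rule DERIV_inverse'[OF DERIV_power_Suc[OF DERIV_ident, THEN DERIV_cong]])
      (use assms in \<open>simp_all del: power_Suc\<close>)
  also have "- (inverse (d ^ Suc m) * (of_nat (Suc m) * d ^ m) * inverse (d ^ Suc m))
      = - of_nat (Suc m) * inverse (d ^ Suc m) / d"
    using assms by (simp add: divide_simps)
  finally show ?thesis .
qed

text \<open>Chain rule through the determinant (Jacobi's formula), the inverse power and
  \<open>Ln\<close>.\<close>

lemma has_derivative_log_kernel:
  fixes Z :: "'n::finite cmat"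
  assumes Z: "Z \<in> D_III"
  shows "((\<lambda>Y. Ln (bergman_kernel Y Y)) has_derivative
    (\<lambda>E. of_nat (CARD('n) + 1) * trace (res Z ** (E ** conj_mat Z + Z ** conj_mat E)))) (at Z)"
proof -
  let ?P = "mat 1 - Z ** conj_mat Z" and ?n = "CARD('n) + 1"
  define d where "d = det ?P"
  define t where "t = (\<lambda>E. trace (res Z ** (E ** conj_mat Z + Z ** conj_mat E)))"
  have d: "d \<noteq> 0" "d = of_real (Re d)" "Re d > 0"
    using det_pos_def[OF D_III_pos_def[OF Z]] D_III_det_nonzero[OF Z]
    by (auto simp: d_def complex_eq_iff)
  have neg: "trace (res Z ** - X) = - trace (res Z ** X)" for X
    by (simp add: matrix_mult.minus_right trace_def sum_negf)
  have "((\<lambda>Y. det (mat 1 - Y ** conj_mat Y)) has_derivative (\<lambda>E. - (d * t E))) (at Z)"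
    by (rule has_derivative_eq_rhs[OF has_derivative_compose[OF has_derivative_defect[OF Z]
          has_derivative_det[OF D_III_det_nonzero[OF Z]]]])
      (simp only: neg d_def t_def res_def[symmetric] mult_minus_right)
  moreover have "((\<lambda>x. inverse (x ^ ?n)) has_field_derivative
      (- of_nat ?n * inverse (d ^ ?n) / d)) (at d)"
    unfolding Suc_eq_plus1[symmetric] by (rule DERIV_inverse_power_Suc[OF d(1)])
  ultimately have "((\<lambda>Y. bergman_kernel Y Y) has_derivative
      (\<lambda>E. (- of_nat ?n * inverse (d ^ ?n) / d) * (- (d * t E)))) (at Z)"
    unfolding bergman_kernel_def d_def has_field_derivative_def by (rule has_derivative_compose)
  moreover have "(Ln has_field_derivative inverse (bergman_kernel Z Z)) (at (bergman_kernel Z Z))"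
  \<comment> \<open>The determinant \<open>d\<close> is a positive real, hence so is the kernel, and
    the principal branch is differentiable there.\<close>
  proof (rule has_field_derivative_Ln)
    have "bergman_kernel Z Z = of_real (inverse (Re d ^ ?n))"
      unfolding bergman_kernel_def d_def[symmetric] by (subst d(2)) simp
    then show "bergman_kernel Z Z \<notin> \<real>\<^sub>\<le>\<^sub>0"
      using d(3) by (simp add: complex_nonpos_Reals_iff not_le)
  qed
  ultimately have "((\<lambda>Y. Ln (bergman_kernel Y Y)) has_derivative
      (\<lambda>E. inverse (bergman_kernel Z Z) * ((- of_nat ?n * inverse (d ^ ?n) / d) * (- (d * t E))))) (at Z)"
    unfolding has_field_derivative_def by (rule has_derivative_compose)
  moreover have "inverse (bergman_kernel Z Z) * ((- of_nat ?n * inverse (d ^ ?n) / d) * (- (d * t E)))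
      = of_nat ?n * t E" for E
  proof -
    have cancel: "inverse K * ((- c * K / d) * (- (d * x))) = c * x" if "K \<noteq> 0" for K c x :: complex
      using that d(1) by simp
    have "inverse (d ^ ?n) \<noteq> 0" using d(1) by (intro nonzero_imp_inverse_nonzero power_not_zero)
    then show ?thesis
      unfolding bergman_kernel_def d_def[symmetric] by (rule cancel)
  qed
  ultimately show ?thesis
    unfolding t_def by simp
qed

text \<open>Of the derivative, \<open>d_dzbar\<close> keeps the part conjugate-linear in the
  direction: passing from \<open>E\<close> to \<open>cscale \<i> E\<close> multiplies the two parts
  by \<open>\<i>\<close> and \<open>- \<i>\<close>, so the linear one cancels.\<close>

lemma d_dzbar_log_kernel:
  fixes Z :: "'n::finite cmat"
  assumes Z: "Z \<in> D_III"
  shows "d_dzbar j k (\<lambda>Y. Ln (bergman_kernel Y Y)) Z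
    = of_nat (CARD('n) + 1) * trace (res Z ** Z ** coord_dir j k)"
  unfolding d_dzbar_def dir_deriv_eqI[OF has_derivative_log_kernel[OF Z]]
  by (simp only: trace_add_mult conj_mat_cscale conj_coord_dir cscale_mult_left cscale_mult_right
      trace_cscale matrix_mul_assoc complex_cnj_i) (simp add: field_simps del: of_nat_add)

text \<open>Now the complex-linear part survives. With \<open>F\<close> the coordinate direction it
  is \<open>A F + A F Z' A Z = A F A'\<close>, traced against \<open>E\<close>.\<close>

lemma d_dz_trace_res:
  fixes Z :: "'n::finite cmat"
  assumes Z: "Z \<in> D_III"
  shows "d_dz l m (\<lambda>Y. c * trace (res Y ** Y ** E)) Z
    = c * trace (res Z ** coord_dir l m ** conj_mat (res Z) ** E)"
proof -
  let ?D = "\<lambda>F. c * trace ((res Z ** F + res Z ** (F ** conj_mat Z + Z ** conj_mat F) ** res Z ** Z) ** E)"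
  have D: "((\<lambda>Y. c * trace (res Y ** Y ** E)) has_derivative ?D) (at Z)"
    by (rule has_derivative_mult_right[OF bounded_linear.has_derivative[OF bounded_linear_trace
          bounded_linear.has_derivative[OF matrix_mult.bounded_linear_left
            matrix_mult.FDERIV[OF has_derivative_res[OF Z] has_derivative_ident]]]])
  have "d_dz l m (\<lambda>Y. c * trace (res Y ** Y ** E)) Z
    = c * trace (res Z ** coord_dir l m ** E) + c * trace (res Z ** coord_dir l m ** conj_mat Z ** res Z ** Z ** E)"
    unfolding d_dz_def dir_deriv_eqI[OF D]
    by (simp only: matrix_mult.add_left matrix_mult.add_right trace_add conj_mat_cscale conj_coord_dir
        cscale_mult_left cscale_mult_right trace_cscale matrix_mul_assoc complex_cnj_i)
      (simp add: field_simps)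
  then show ?thesis
    by (simp add: conj_res_expand[OF Z] matrix_mult.add_left matrix_mult.add_right trace_add
        matrix_mul_assoc distrib_left)
qed

lemma bergman_metric_eq:
  fixes Z :: "'n::{finite,linorder} cmat"
  assumes Z: "Z \<in> D_III" and "U \<in> Symm" "V \<in> Symm"
  shows "bergman_metric Z U V = metric_form Z U V"
proof -
  let ?I = "{(l :: 'n, m). l \<le> m}"
  let ?A = "res Z" and ?n = "of_nat CARD('n) + 1 :: complex"
  have n: "?n \<noteq> 0" by (metis of_nat_Suc of_nat_neq_0 add.commute)
  have coef: "d_dz l m (d_dzbar j k (\<lambda>Y. Ln (bergman_kernel Y Y))) Z
    = ?n * trace (?A ** coord_dir l m ** conj_mat ?A ** coord_dir j k)" for l m j k
  proof -
    have "dir_deriv E (d_dzbar j k (\<lambda>Y. Ln (bergman_kernel Y Y))) Z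
      = dir_deriv E (\<lambda>Y. ?n * trace (res Y ** Y ** coord_dir j k)) Z" if "E \<in> Symm" for E
      by (rule dir_deriv_cong[OF _ Z that]) (simp add: d_dzbar_log_kernel)
    then show ?thesis
      unfolding d_dz_trace_res[OF Z, symmetric]
      by (simp add: d_dz_def coord_dir_in_Symm cscale_in_Symm)
  qed
  have sum_trace: "trace (sum f S) = (\<Sum>x\<in>S. trace (f x))" for f :: "'n \<times> 'n \<Rightarrow> 'n cmat" and S
    using bounded_linear_trace by (rule linear_sum[OF bounded_linear.linear])
  \<comment> \<open>\<open>conj_mat V\<close> is symmetric too, with conjugated coordinates; these
    are the factors \<open>cnj (V $ j $ k)\<close> of the metric.\<close>
  have V: "conj_mat V = (\<Sum>(j, k)\<in>?I. cscale (cnj (V $ j $ k)) (coord_dir j k))"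
    using Symm_expand[OF conj_mat_in_Symm[OF assms(3)]] by simp
  have 1: "trace (X ** conj_mat V) = (\<Sum>(j, k)\<in>?I. trace (X ** coord_dir j k) * cnj (V $ j $ k))" for X
    unfolding V by (simp add: matrix_mult.sum_right case_prod_unfold sum_trace cscale_mult_right
        trace_cscale mult.commute)
  have 2: "trace (?A ** U ** Y) = (\<Sum>(l, m)\<in>?I. trace (?A ** coord_dir l m ** Y) * U $ l $ m)" for Y
    by (subst (1) Symm_expand[OF assms(2)])
      (simp add: matrix_mult.sum_right matrix_mult.sum_left case_prod_unfold sum_trace
        cscale_mult_left cscale_mult_right trace_cscale mult.commute)
  have "metric_form Z U V = (\<Sum>(l, m)\<in>?I.
      trace (?A ** coord_dir l m ** conj_mat ?A ** conj_mat V) * U $ l $ m)"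
    unfolding metric_form_def using 2[of "conj_mat ?A ** conj_mat V"]
    by (simp only: matrix_mul_assoc)
  also have "\<dots> = (\<Sum>(l, m)\<in>?I. \<Sum>(j, k)\<in>?I.
      trace (?A ** coord_dir l m ** conj_mat ?A ** coord_dir j k) * U $ l $ m * cnj (V $ j $ k))"
    unfolding 1 by (simp add: case_prod_unfold sum_distrib_left mult_ac)
  also have "\<dots> = bergman_metric Z U V"
  proof -
    have "1 / ?n * (?n * x * y * z) = x * y * z" for x y z
      using n by simp
    then show ?thesis
      by (simp only: bergman_metric_def coef sum_distrib_left case_prod_unfold)
  qed
  finally show ?thesis by simp
qed

lemma kahler_form_eq:
  assumes "Z \<in> D_III" "U \<in> Symm" "V \<in> Symm"
  shows "kahler_form Z U V = - 2 * Im (metric_form Z U V)"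
  by (simp add: kahler_form_def bergman_metric_eq[OF assms])


section \<open>The Kaehler form is symplectic\<close>

text \<open>Hermitian symmetry, by cyclicity of the trace; it makes the imaginary part
  antisymmetric.\<close>

lemma metric_form_cnj:
  "metric_form Z V U = cnj (metric_form Z U V)"
proof -
  let ?A = "res Z"
  have "cnj (metric_form Z U V) = trace ((conj_mat ?A ** conj_mat U) ** (?A ** V))"
    by (simp add: metric_form_def conj_mat_mult matrix_mul_assoc flip: trace_conj_mat)
  also have "\<dots> = metric_form Z V U"
    by (subst trace_mul_sym) (simp add: metric_form_def matrix_mul_assoc)
  finally show ?thesis by simp
qed

lemma metric_form_cscale_left: "metric_form Z (cscale c U) V = c * metric_form Z U V"
  and metric_form_cscale_right: "metric_form Z U (cscale c V) = cnj c * metric_form Z U V"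
  by (simp_all add: metric_form_def cscale_mult_left cscale_mult_right conj_mat_cscale trace_cscale)

lemma metric_form_linear_left:
  "metric_form Z (a *\<^sub>R U + b *\<^sub>R V) W = a *\<^sub>R metric_form Z U W + b *\<^sub>R metric_form Z V W"
  by (simp add: metric_form_def matrix_mult.add_left matrix_mult.add_right matrix_mult.scaleR_left
      matrix_mult.scaleR_right trace_add linear_scale[OF bounded_linear.linear[OF bounded_linear_trace]])

lemma trace_mult_conj_Symm:
  assumes "W \<in> Symm"
  shows "trace (W ** conj_mat W) = of_real (\<Sum>i\<in>UNIV. \<Sum>j\<in>UNIV. (cmod (W $ i $ j))\<^sup>2)"
proof -
  have "W $ j $ i = W $ i $ j" for i j
    using Symm_eqD[OF assms] by (metis (no_types) transpose_def vec_lambda_beta)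
  then show ?thesis
    by (simp add: trace_def matrix_matrix_mult_def complex_norm_square del: of_real_power)
qed

lemma metric_form_nondegenerate:
  fixes Z :: "'n::finite cmat"
  assumes Z: "Z \<in> D_III" and U: "U \<in> Symm"
    and zero: "\<And>V. V \<in> Symm \<Longrightarrow> Im (metric_form Z U V) = 0"
  shows "U = 0"
proof -
  let ?A = "res Z" and ?P = "mat 1 - Z ** conj_mat Z"
  let ?W = "?A ** U ** conj_mat ?A"
  have W: "?W \<in> Symm"
    by (simp add: Symm_def matrix_transpose_mul transpose_res[OF Z] transpose_conj_res[OF Z]
        Symm_eqD[OF U] matrix_mul_assoc)
  \<comment> \<open>The factor \<open>\<i>\<close> moves the real number \<open>g(U, W)\<close>, the
    squared norm of \<open>?W\<close>, into the imaginary part, where the hypothesis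
    applies.\<close>
  have "Im (metric_form Z U (cscale \<i> ?W)) = 0"
    by (intro zero cscale_in_Symm W)
  then have "(\<Sum>i\<in>UNIV. \<Sum>j\<in>UNIV. (cmod (?W $ i $ j))\<^sup>2) = 0"
    unfolding metric_form_cscale_right unfolding metric_form_def trace_mult_conj_Symm[OF W] by simp
  then have "?W = 0"
    by (simp add: sum_nonneg_eq_0_iff sum_nonneg vec_eq_iff)
  have "U = (?P ** ?A) ** U ** conj_mat (?A ** ?P)"
    by (simp add: res_left[OF Z] res_right[OF Z])
  also have "\<dots> = ?P ** ?W ** conj_mat ?P"
    by (simp only: conj_mat_mult matrix_mul_assoc)
  finally show ?thesis using \<open>?W = 0\<close> by simp
qed

lemma Ck_on_diff:
  assumes "Ck_on k V M f" "Ck_on k V M g"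
  shows "Ck_on k V M (\<lambda>x. f x - g x)"
  using Ck_on_add[OF assms(1) Ck_on_linear_compose[OF bounded_linear_minus[OF bounded_linear_ident] assms(2)]]
  by simp

lemma Ck_on_res: "Ck_on k V D_III res"
  unfolding res_def[abs_def]
  by (intro Ck_on_matrix_inv D_III_det_nonzero Ck_on_diff Ck_on_const
      Ck_on_bilinear[OF bounded_bilinear_matrix_mult] Ck_on_linear[OF bounded_linear_ident]
      Ck_on_linear[OF bounded_linear_conj_mat])

lemma Ck_on_metric_form: "Ck_on k V D_III (\<lambda>Z. metric_form Z u v)"
  unfolding metric_form_def
  by (rule Ck_on_linear_compose[OF bounded_linear_trace] Ck_on_bilinear[OF bounded_bilinear_matrix_mult]
      Ck_on_const Ck_on_res Ck_on_linear_compose[OF bounded_linear_conj_mat Ck_on_res])+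

text \<open>The \<open>F\<close> of the overview, to which all four terms of the derivative of the
  metric are reduced.\<close>

definition cubic_form :: "'n::finite cmat \<Rightarrow> 'n cmat \<Rightarrow> 'n cmat \<Rightarrow> 'n cmat \<Rightarrow> complex"
  where "cubic_form Z u v w =
    trace (res Z ** u ** conj_mat (res Z) ** conj_mat Z ** v ** conj_mat (res Z) ** conj_mat w)"

text \<open>The product rule hits two resolvents, each contributing two terms. Facts
  \<open>1\<close> and \<open>4\<close> below come from \<open>A\<close>, facts \<open>2\<close> and
  \<open>3\<close> from \<open>A'\<close>.\<close>

lemma has_derivative_metric_form:
  fixes Z :: "'n::finite cmat"
  assumes Z: "Z \<in> D_III"
  shows "((\<lambda>Y. metric_form Y v w) has_derivative
    (\<lambda>u. cubic_form Z u v w + cubic_form Z v u w + cnj (cubic_form Z u w v) + cnj (cubic_form Z w u v)))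
    (at Z)"
proof -
  let ?A = "res Z" and ?B = "conj_mat (res Z)" and ?Z' = "conj_mat Z"
  let ?D = "\<lambda>u. ?A ** (u ** ?Z' + Z ** conj_mat u) ** ?A"
  have "((\<lambda>Y. metric_form Y v w) has_derivative
    (\<lambda>u. trace ((?A ** v ** conj_mat (?D u) + ?D u ** v ** ?B) ** conj_mat w))) (at Z)"
    unfolding metric_form_def
    by (rule bounded_linear.has_derivative[OF bounded_linear_trace
          bounded_linear.has_derivative[OF matrix_mult.bounded_linear_left
            matrix_mult.FDERIV[OF bounded_linear.has_derivative[OF matrix_mult.bounded_linear_left
                has_derivative_res[OF Z]]
              bounded_linear.has_derivative[OF bounded_linear_conj_mat has_derivative_res[OF Z]]]]])
  moreover have "trace ((?A ** v ** conj_mat (?D u) + ?D u ** v ** ?B) ** conj_mat w)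
      = cubic_form Z u v w + cubic_form Z v u w + cnj (cubic_form Z u w v) + cnj (cubic_form Z w u v)" for u
  proof -
    have cnj_cubic: "cnj (cubic_form Z a b c) = trace (?B ** conj_mat a ** ?A ** Z ** conj_mat b ** ?A ** c)" for a b c
      by (simp add: cubic_form_def conj_mat_mult flip: trace_conj_mat)
    have 1: "trace (?A ** u ** ?Z' ** ?A ** v ** ?B ** conj_mat w) = cubic_form Z u v w"
      by (simp only: cubic_form_def conj_res_mult[OF Z] flip: matrix_mul_assoc)
    have 2: "trace (?A ** v ** ?B ** ?Z' ** u ** ?B ** conj_mat w) = cubic_form Z v u w"
      by (simp only: cubic_form_def)
    have 3: "trace (?A ** v ** ?B ** conj_mat u ** Z ** ?B ** conj_mat w) = cnj (cubic_form Z u w v)"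
    proof -
      \<comment> \<open>\<open>Z A' = A Z\<close> restores the pattern of \<open>cnj_cubic\<close>;
        rotating \<open>?A ** v\<close> to the end then completes it.\<close>
      have eq: "?A ** v ** ?B ** conj_mat u ** Z ** ?B ** conj_mat w
        = (?A ** v) ** (?B ** conj_mat u ** (?A ** Z) ** conj_mat w)"
        by (simp only: res_mult[OF Z] matrix_mul_assoc)
      show ?thesis
        unfolding eq trace_mul_sym[of "?A ** v"] by (simp only: cnj_cubic matrix_mul_assoc)
    qed
    have 4: "trace (?A ** Z ** conj_mat u ** ?A ** v ** ?B ** conj_mat w) = cnj (cubic_form Z w u v)"
    proof -
      have eq: "?A ** Z ** conj_mat u ** ?A ** v ** ?B ** conj_mat w
        = (?A ** Z ** conj_mat u ** ?A ** v) ** (?B ** conj_mat w)"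
        by (simp only: matrix_mul_assoc)
      show ?thesis
        unfolding eq trace_mul_sym[of _ "?B ** conj_mat w"] by (simp only: cnj_cubic matrix_mul_assoc)
    qed
    show ?thesis
      by (simp only: conj_mat_mult conj_mat_add conj_mat_conj_mat matrix_mult.add_left
          matrix_mult.add_right trace_add matrix_mul_assoc 1 2 3 4) (simp only: ac_simps)
  qed
  ultimately show ?thesis by simp
qed

lemma vector_derivative_kahler_form:
  fixes Z :: "'n::{finite,linorder} cmat"
  assumes Z: "Z \<in> D_III" and uvw: "u \<in> Symm" "v \<in> Symm" "w \<in> Symm"
  shows "vector_derivative (\<lambda>s. kahler_form (Z + s *\<^sub>R u) v w) (at 0) =
    - 2 * Im (cubic_form Z u v w + cubic_form Z v u w - cubic_form Z u w v - cubic_form Z w u v)"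
proof -
  let ?F = "cubic_form Z"
  have "((\<lambda>s. metric_form (Z + s *\<^sub>R u) v w) has_vector_derivative
      ?F u v w + ?F v u w + cnj (?F u w v) + cnj (?F w u v)) (at 0)"
    by (rule has_vector_derivative_line[OF has_derivative_metric_form[OF Z]])
  moreover have "bounded_linear (\<lambda>z. - 2 * Im z)"
    by (intro bounded_linear_const_mult bounded_linear_Im)
  ultimately have "((\<lambda>s. - 2 * Im (metric_form (Z + s *\<^sub>R u) v w)) has_vector_derivative
      - 2 * Im (?F u v w + ?F v u w + cnj (?F u w v) + cnj (?F w u v))) (at 0)"
    by (rule bounded_linear.has_vector_derivative[rotated])
  then have "vector_derivative (\<lambda>s. - 2 * Im (metric_form (Z + s *\<^sub>R u) v w)) (at 0)
      = - 2 * Im (?F u v w + ?F v u w - ?F u w v - ?F w u v)"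
    by (simp add: vector_derivative_at)
  moreover have "vector_derivative (\<lambda>s. kahler_form (Z + s *\<^sub>R u) v w) (at 0)
      = vector_derivative (\<lambda>s. - 2 * Im (metric_form (Z + s *\<^sub>R u) v w)) (at 0)"
    by (rule vector_derivative_cong_eq)
      (use D_III_line[OF Z uvw(1)] in \<open>auto elim!: eventually_mono simp: kahler_form_eq uvw\<close>)
  ultimately show ?thesis by simp
qed

lemma symplectic_form_kahler_form:
  "symplectic_form Symm (D_III :: 'n::{finite,linorder} cmat set) kahler_form"
  unfolding symplectic_form_def
proof (intro conjI ballI allI impI)
  show "open_submanifold Symm (D_III :: 'n cmat set)"
    by (simp add: open_submanifold_def subspace_Symm openin_D_III)
next
  fix Z u v w :: "'n cmat" and a b :: real
  assume Z: "Z \<in> D_III" and uvw: "u \<in> Symm" "v \<in> Symm" "w \<in> Symm"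
  then have "a *\<^sub>R u + b *\<^sub>R v \<in> Symm"
    by (intro subspace_add[OF subspace_Symm] subspace_scale[OF subspace_Symm])
  with Z uvw show "kahler_form Z (a *\<^sub>R u + b *\<^sub>R v) w = a * kahler_form Z u w + b * kahler_form Z v w"
    by (simp add: kahler_form_eq metric_form_linear_left algebra_simps)
next
  fix Z u v :: "'n cmat"
  assume "Z \<in> D_III" "u \<in> Symm" "v \<in> Symm"
  then show "kahler_form Z u v = - kahler_form Z v u"
    using metric_form_cnj[of Z u v] by (simp add: kahler_form_eq)
next
  fix Z u :: "'n cmat"
  assume "Z \<in> D_III" "u \<in> Symm" "\<forall>v\<in>Symm. kahler_form Z u v = 0"
  then show "u = 0"
    by (intro metric_form_nondegenerate[of Z]) (auto simp: kahler_form_eq)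
next
  fix u v :: "'n cmat"
  assume uv: "u \<in> Symm" "v \<in> Symm"
  have "bounded_linear (\<lambda>z. - 2 * Im z)"
    by (intro bounded_linear_const_mult bounded_linear_Im)
  then have "smooth_in Symm D_III (\<lambda>Z. - 2 * Im (metric_form Z u v))"
    unfolding smooth_in_def by (intro allI Ck_on_linear_compose[OF _ Ck_on_metric_form])
  then show "smooth_in Symm D_III (\<lambda>Z. kahler_form Z u v)"
    by (rule smooth_in_cong) (simp add: kahler_form_eq uv)
next
  fix Z u v w :: "'n cmat"
  assume "Z \<in> D_III" "u \<in> Symm" "v \<in> Symm" "w \<in> Symm"
  then show "vector_derivative (\<lambda>s. kahler_form (Z + s *\<^sub>R u) v w) (at 0) +
      vector_derivative (\<lambda>s. kahler_form (Z + s *\<^sub>R v) w u) (at 0) +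
      vector_derivative (\<lambda>s. kahler_form (Z + s *\<^sub>R w) u v) (at 0) = 0"
    \<comment> \<open>Each of the six permutations of \<open>u, v, w\<close> occurs in the cyclic
      sum once with each sign.\<close>
    by (simp add: vector_derivative_kahler_form)
qed


section \<open>The circle action and its moment map\<close>

lemma unit_square_mult_cnj:
  assumes "t \<in> sphere 0 1"
  shows "t\<^sup>2 * cnj (t\<^sup>2) = 1"
  using assms by (simp add: norm_power flip: complex_norm_square del: complex_cnj_power)

text \<open>The scalars combine to \<open>t\<^sup>2 * cnj (t\<^sup>2) = 1\<close>. Invariance of the
  domain, the resolvent and \<open>mu_T\<close> all follow from this.\<close>

lemma defect_elliptic_action:
  assumes "t \<in> sphere 0 1"
  shows "mat 1 - elliptic_action t Z ** conj_mat (elliptic_action t Z) = mat 1 - Z ** conj_mat Z"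
proof -
  have "elliptic_action t Z ** conj_mat (elliptic_action t Z) = cscale (t\<^sup>2 * cnj (t\<^sup>2)) (Z ** conj_mat Z)"
    by (simp only: elliptic_action_def conj_mat_cscale cscale_mult_left cscale_mult_right
        cscale_cscale mult.commute)
  then show ?thesis by (simp add: unit_square_mult_cnj[OF assms] del: complex_cnj_power)
qed

lemma elliptic_action_D_III:
  assumes "t \<in> sphere 0 1" "Z \<in> D_III"
  shows "elliptic_action t Z \<in> D_III"
  using assms defect_elliptic_action[OF assms(1), of Z]
  by (simp add: D_III_def elliptic_action_def cscale_in_Symm)

lemma smooth_elliptic_action:
  "smooth_circle_action Symm (D_III :: 'n::finite cmat set) elliptic_action"
  unfolding smooth_circle_action_def
proof (intro conjI ballI)
  show "elliptic_action t Z \<in> D_III" if "t \<in> sphere 0 1" "Z \<in> D_III" for t and Z :: "'n cmat"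
    using that by (rule elliptic_action_D_III)
  show "elliptic_action 1 Z = Z" for Z :: "'n cmat"
    by (simp add: elliptic_action_def)
  show "elliptic_action (s * t) Z = elliptic_action s (elliptic_action t Z)" for s t and Z :: "'n cmat"
    by (simp add: elliptic_action_def power_mult_distrib)
  \<comment> \<open>Since \<open>(cis s)\<^sup>2 = cis (2 * s)\<close>, the action is a bilinear map
    applied to a smooth and a linear function.\<close>
  have "bounded_linear (\<lambda>p :: real \<times> 'n cmat. 2 * fst p)"
    by (intro bounded_linear_const_mult bounded_linear_fst)
  then have "smooth_in (UNIV \<times> Symm) (UNIV \<times> D_III) (\<lambda>p :: real \<times> 'n cmat. cscale (cis (2 * fst p)) (snd p))"
    unfolding smooth_in_def
    by (intro allI Ck_on_bilinear[OF bounded_bilinear_cscale] Ck_on_cis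
        Ck_on_linear[OF bounded_linear_snd])
  then show "smooth_in (UNIV \<times> Symm) (UNIV \<times> D_III)
      (\<lambda>(s, Z :: 'n cmat). elliptic_action (cis s) Z)"
    by (rule smooth_in_cong) (auto simp: elliptic_action_def Complex.DeMoivre)
qed

text \<open>The action is linear, hence its own derivative; the resolvent is unchanged and the two
  arguments contribute \<open>t\<^sup>2\<close> and its conjugate.\<close>

lemma elliptic_action_preserves_kahler_form:
  fixes t :: complex
  assumes t: "t \<in> sphere 0 1"
  shows "preserves_form Symm (D_III :: 'n::{finite,linorder} cmat set) kahler_form (elliptic_action t)"
  unfolding preserves_form_def
proof (intro ballI exI conjI)
  fix Z :: "'n cmat"
  assume Z: "Z \<in> D_III"
  let ?L = "cscale (t\<^sup>2) :: 'n cmat \<Rightarrow> 'n cmat"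
  show "(elliptic_action t has_derivative ?L) (at Z within D_III)"
    unfolding elliptic_action_def[abs_def]
    by (rule bounded_linear_imp_has_derivative
        [OF bounded_bilinear.bounded_linear_right[OF bounded_bilinear_cscale]])
  show L: "?L u \<in> Symm" if "u \<in> Symm" for u
    using that by (rule cscale_in_Symm)
  show "kahler_form (elliptic_action t Z) (?L u) (?L v) = kahler_form Z u v"
    if "u \<in> Symm" "v \<in> Symm" for u v
  proof -
    have "metric_form (elliptic_action t Z) (?L u) (?L v) = (t\<^sup>2 * cnj (t\<^sup>2)) * metric_form Z u v"
      unfolding metric_form_cscale_left metric_form_cscale_right
      by (simp add: metric_form_def res_def defect_elliptic_action[OF t])
    then show ?thesis
      unfolding unit_square_mult_cnj[OF t]
      by (simp add: kahler_form_eq elliptic_action_D_III[OF t Z] Z L that)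
  qed
qed

lemma fundamental_field_elliptic_action:
  "fundamental_field elliptic_action X Z = cscale (2 * X * \<i>) (Z :: 'n::finite cmat)"
proof -
  have "((\<lambda>s. cis (s * (2 * X))) has_derivative (\<lambda>s. (s * (2 * X)) *\<^sub>R (\<i> * cis (0 * (2 * X))))) (at 0)"
    by (intro has_derivative_cis has_derivative_mult_left has_derivative_ident)
  then have "((\<lambda>s. cis (s * (2 * X))) has_vector_derivative 2 * X * \<i>) (at 0)"
    by (simp add: has_vector_derivative_def scaleR_conv_of_real mult_ac)
  then have "((\<lambda>s. cscale (cis (s * (2 * X))) Z) has_vector_derivative cscale (2 * X * \<i>) Z) (at 0)"
    by (rule bounded_linear.has_vector_derivative
        [OF bounded_bilinear.bounded_linear_left[OF bounded_bilinear_cscale]])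
  moreover have "(cis (s * X))\<^sup>2 = cis (s * (2 * X))" for s
    by (simp add: Complex.DeMoivre mult_ac)
  ultimately show ?thesis
    by (simp add: fundamental_field_def elliptic_action_def vector_derivative_at)
qed

lemma mu_T_eq: "mu_T Z = - 2 * Re (trace (res Z))"
  by (simp add: mu_T_def res_def)

text \<open>Transposition conjugates the resolvent but preserves its trace.\<close>

lemma trace_res_real:
  assumes "Z \<in> D_III"
  shows "Im (trace (res Z)) = 0"
proof -
  have "cnj (trace (res Z)) = trace (res Z)"
    by (metis trace_conj_mat trace_transpose transpose_res[OF assms])
  then show ?thesis by (simp add: complex_eq_iff)
qed

text \<open>The two summands are \<open>g(v, Z)\<close> and \<open>g(Z, v)\<close>, which are
  conjugate.\<close>

lemma trace_derivative_res:
  fixes Z :: "'n::finite cmat"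
  assumes Z: "Z \<in> D_III"
  shows "trace (res Z ** (v ** conj_mat Z + Z ** conj_mat v) ** res Z)
    = of_real (2 * Re (metric_form Z Z v))"
proof -
  let ?A = "res Z"
  have "trace (?A ** v ** conj_mat Z ** ?A) = metric_form Z v Z"
    by (simp only: metric_form_def conj_res_mult[OF Z] flip: matrix_mul_assoc)
  moreover have "trace (?A ** Z ** conj_mat v ** ?A) = metric_form Z Z v"
    unfolding trace_mul_sym[of _ ?A] metric_form_def
    by (simp only: matrix_mul_assoc res_mult[OF Z, symmetric])
      (simp only: res_mult[OF Z, symmetric] flip: matrix_mul_assoc)
  ultimately show ?thesis
    using metric_form_cnj[of Z v Z]
    by (simp add: matrix_mult.add_left matrix_mult.add_right matrix_mul_assoc trace_add complex_eq_iff)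
qed

lemma mu_T_hamiltonian:
  fixes Z :: "'n::{finite,linorder} cmat"
  assumes Z: "Z \<in> D_III"
  shows "\<exists>L. ((\<lambda>Y. mu_T Y * X) has_derivative L) (at Z within D_III) \<and>
    (\<forall>v\<in>Symm. L v = kahler_form Z (fundamental_field elliptic_action X Z) v)"
proof (intro exI conjI ballI)
  let ?L = "\<lambda>v. - 2 * Re (trace (res Z ** (v ** conj_mat Z + Z ** conj_mat v) ** res Z)) * X"
  show "((\<lambda>Y. mu_T Y * X) has_derivative ?L) (at Z within D_III)"
    unfolding mu_T_eq
    by (intro has_derivative_at_withinI[OF has_derivative_mult_left[OF has_derivative_mult_right[OF
        bounded_linear.has_derivative[OF bounded_linear_Re
          bounded_linear.has_derivative[OF bounded_linear_trace has_derivative_res[OF Z]]]]]])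
  fix v :: "'n cmat"
  assume "v \<in> Symm"
  \<comment> \<open>Both sides equal \<open>- 4 * X * Re (metric_form Z Z v)\<close>, because
    multiplying by \<open>\<i>\<close> turns the real part into the imaginary part.\<close>
  then show "?L v = kahler_form Z (fundamental_field elliptic_action X Z) v"
    unfolding trace_derivative_res[OF Z] fundamental_field_elliptic_action
    by (simp add: kahler_form_eq[OF Z] cscale_in_Symm D_III_Symm[OF Z] metric_form_cscale_left)
qed

lemma smooth_mu_T: "smooth_in V D_III mu_T"
proof -
  have "bounded_linear (\<lambda>A. - 2 * Re (trace A))"
    by (intro bounded_linear_const_mult bounded_linear_compose[OF bounded_linear_Re bounded_linear_trace])
  then show ?thesis
    unfolding smooth_in_def mu_T_eq[abs_def] by (intro allI Ck_on_linear_compose[OF _ Ck_on_res])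
qed

text \<open>The first conjunct certifies that the real part taken in \<open>mu_T\<close> discards
  nothing on the domain.\<close>

theorem proposition4p4:
  shows "(\<forall>Z\<in>(D_III :: 'n::{finite,linorder} cmat set).
            complex_of_real (mu_T Z) = - 2 * trace (matrix_inv (mat 1 - Z ** conj_mat Z))) \<and>
         circle_moment_map Symm (D_III :: 'n cmat set) kahler_form elliptic_action mu_T"
proof (intro conjI ballI)
  fix Z :: "'n cmat"
  assume "Z \<in> D_III"
  then show "complex_of_real (mu_T Z) = - 2 * trace (matrix_inv (mat 1 - Z ** conj_mat Z))"
    using trace_res_real[of Z] by (simp add: mu_T_eq complex_eq_iff flip: res_def)
next
  show "circle_moment_map Symm (D_III :: 'n cmat set) kahler_form elliptic_action mu_T"
    unfolding circle_moment_map_def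
    using symplectic_form_kahler_form smooth_elliptic_action elliptic_action_preserves_kahler_form
      smooth_mu_T mu_T_hamiltonian
    by (auto simp: mu_T_def defect_elliptic_action)
qed

end
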